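(* Suppose $s$ is a nonnegative integer and $l$ is a positive integer. Then $\tau_{s}(s+2,b) \leq l-1$ for every positive integer $b$ with $b \leq (l+s+1)^{s+2} -1$.
   Context: All graphs are finite and simple. For graphs $G,H$ on disjoint vertex sets, the join $G \vee H$ is the graph consisting of $G$, $H$, and all edges joining a vertex of $G$ to a vertex of $H$; $K_n$ is the complete graph on $n$ vertices, and $K_0 \vee G$ is understood as $G$. $K_{a,b}$ is the complete bipartite graph with partite sets of sizes $a$ and $b$. $\chi$ denotes chromatic number and $\chi_\ell$ list chromatic number. For a nonnegative integer $s$ and positive integers $a,b$, $\tau_s(a,b)$ denotes the smallest nonnegative integer $n$ such that $\chi_\ell(K_n \vee K_{a,b}) - \chi(K_n \vee K_{a,b}) \leq s$. *)

theory Defs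
  imports "Graph_Theory.Graph_Theory"
begin

text \<open>
  Finite simple graphs are modelled as in \<open>Graph_Theory\<close>: symmetric loop-free finite pair
  digraphs, that is, instances of the locale \<open>pair_graph\<close>. The pair \<open>(u, v)\<close> and its
  reversal \<open>(v, u)\<close> together represent the undirected edge \<open>uv\<close>.
\<close>

definition graph_join :: "'a pair_pre_digraph \<Rightarrow> 'b pair_pre_digraph \<Rightarrow> ('a + 'b) pair_pre_digraph" where
  "graph_join G H =
    \<lparr> pverts = pverts G <+> pverts H,
      parcs = map_prod Inl Inl ` parcs G \<union> map_prod Inr Inr ` parcs H
        \<union> (Inl ` pverts G) \<times> (Inr ` pverts H) \<union> (Inr ` pverts H) \<times> (Inl ` pverts G) \<rparr>"

definition complete_graph :: "nat \<Rightarrow> nat pair_pre_digraph" where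
  "complete_graph n = \<lparr> pverts = {..<n}, parcs = {(u, v). u < n \<and> v < n \<and> u \<noteq> v} \<rparr>"

definition complete_bipartite_graph :: "nat \<Rightarrow> nat \<Rightarrow> (nat + nat) pair_pre_digraph" where
  "complete_bipartite_graph a b =
    \<lparr> pverts = {..<a} <+> {..<b},
      parcs = (Inl ` {..<a}) \<times> (Inr ` {..<b}) \<union> (Inr ` {..<b}) \<times> (Inl ` {..<a}) \<rparr>"

definition proper_coloring :: "'a pair_pre_digraph \<Rightarrow> ('a \<Rightarrow> nat) \<Rightarrow> bool" where
  "proper_coloring G c \<longleftrightarrow> (\<forall>(u, v) \<in> parcs G. c u \<noteq> c v)"

definition colorable :: "'a pair_pre_digraph \<Rightarrow> nat \<Rightarrow> bool" where
  "colorable G k \<longleftrightarrow> (\<exists>c. proper_coloring G c \<and> (\<forall>v \<in> pverts G. c v < k))"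

definition chromatic_number :: "'a pair_pre_digraph \<Rightarrow> nat" where
  "chromatic_number G = (LEAST k. colorable G k)"

text \<open>
  Taking colours in \<open>nat\<close> loses no generality: the lists on a finite graph contain
  finitely many colours altogether. Finiteness of the lists has to be required separately, because
  \<open>card\<close> is \<open>0\<close> on infinite sets.
\<close>

definition list_assignment :: "'a pair_pre_digraph \<Rightarrow> nat \<Rightarrow> ('a \<Rightarrow> nat set) \<Rightarrow> bool" where
  "list_assignment G k L \<longleftrightarrow> (\<forall>v \<in> pverts G. finite (L v) \<and> card (L v) = k)"

definition choosable :: "'a pair_pre_digraph \<Rightarrow> nat \<Rightarrow> bool" where
  "choosable G k \<longleftrightarrow>
    (\<forall>L. list_assignment G k L \<longrightarrow> (\<exists>c. proper_coloring G c \<and> (\<forall>v \<in> pverts G. c v \<in> L v)))"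

definition list_chromatic_number :: "'a pair_pre_digraph \<Rightarrow> nat" where
  "list_chromatic_number G = (LEAST k. choosable G k)"

definition tau :: "nat \<Rightarrow> nat \<Rightarrow> nat \<Rightarrow> nat" where
  "tau s a b = (LEAST n.
     int (list_chromatic_number (graph_join (complete_graph n) (complete_bipartite_graph a b)))
       - int (chromatic_number (graph_join (complete_graph n) (complete_bipartite_graph a b)))
     \<le> int s)"

lemma complete_graph: "K\<^bsub>n\<^esub> (with_proj (complete_graph n))"
  unfolding complete_digraph_pair_def complete_graph_def by auto

lemma complete_bipartite_graph: "K\<^bsub>a,b\<^esub> (with_proj (complete_bipartite_graph a b))"
  unfolding complete_bipartite_digraph_pair_def complete_bipartite_graph_def
  by (intro conjI exI[of _ "Inl ` {..<a}"] exI[of _ "Inr ` {..<b}"])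
    (auto simp: card_image)

lemma pair_graph_join:
  assumes "pair_graph G" "pair_graph H"
  shows "pair_graph (graph_join G H)"
proof -
  interpret G: pair_graph G by fact
  interpret H: pair_graph H by fact
  have "sym (parcs G)" "sym (parcs H)"
    using G.pair_sym_arcs H.pair_sym_arcs by (simp_all add: symmetric_def)
  then have "symmetric (with_proj (graph_join G H))"
    by (auto simp: symmetric_def graph_join_def intro!: symI dest: symD)
  then show ?thesis
    using G.pair_finite_verts H.pair_finite_verts G.pair_finite_arcs H.pair_finite_arcs
    by unfold_locales
      (auto simp: graph_join_def dest: G.in_arcsD1 G.in_arcsD2 H.in_arcsD1 H.in_arcsD2
        G.pair_no_loops H.pair_no_loops)
qed

text \<open>Joining with \<open>K\<^sub>0\<close> changes a graph only by the renaming \<open>Inr\<close> of its vertices.\<close>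

lemma graph_join_complete_graph_0:
  "graph_join (complete_graph 0) G = \<lparr> pverts = Inr ` pverts G, parcs = map_prod Inr Inr ` parcs G \<rparr>"
  by (auto simp: graph_join_def complete_graph_def)

end

theory Submission
  imports Defs "HOL-Library.FuncSet"
begin

text \<open>
  Put \<open>n = l - 1\<close>, \<open>a = s + 2\<close> and \<open>m = n + a\<close>. Since \<open>K\<^sub>n \<or> K\<^sub>a\<^sub>,\<^sub>b\<close> has chromatic number \<open>n + 2\<close>,
  it suffices to colour it from lists of size \<open>m\<close> whenever \<open>b < m\<^sup>a\<close>. A colouring of \<open>K\<^sub>n\<close> and of
  the part of size \<open>a\<close> fails to extend only if its colours are exactly the \<open>m\<close> colours of the list of
  one of the \<open>b\<close> remaining vertices. If two lists on the part of size \<open>a\<close> meet, one can get by with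
  fewer than \<open>m\<close> colours. Otherwise it is enough to find \<open>m\<^sup>a\<close> colourings with distinct colour sets.
  Colour \<open>K\<^sub>n\<close> by an injection \<open>x\<close> with image \<open>X\<close>, and let \<open>u\<close> be the number of colours in \<open>X\<close> that
  occur in lists \<open>A\<^sub>j\<close> on the part of size \<open>a\<close>. By the Weierstrass product inequality, \<open>x\<close> extends in
  at least \<open>m\<^sup>a - u m\<^sup>a\<^sup>-\<^sup>1\<close> ways. For each of these \<open>u\<close> colours, recolour its vertex by a colour
  outside \<open>X\<close> and let the \<open>A\<^sub>j\<close> still avoid all of \<open>X\<close>: this yields at least
  \<open>(a - 1) m\<^sup>a\<^sup>-\<^sup>1 \<ge> m\<^sup>a\<^sup>-\<^sup>1\<close> further colour sets, and the colour of \<open>X\<close> missing from such a set tells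
  which vertex was recoloured.
\<close>

section \<open>Greedy choice of colours and counting of transversals\<close>

lemma greedy_distinct_representatives:
  fixes F :: "'i \<Rightarrow> 'c set"
  assumes "finite I" "finite C"
    and "\<And>i. i \<in> I \<Longrightarrow> card I + card C \<le> card (F i)"
  obtains f where "inj_on f I" "\<And>i. i \<in> I \<Longrightarrow> f i \<in> F i - C"
proof -
  have "\<exists>f. inj_on f I \<and> (\<forall>i\<in>I. f i \<in> F i - C)"
    using assms(1,3)
  proof (induction I rule: finite_induct)
    case empty
    then show ?case by simp
  next
    case (insert k I)
    then obtain f where f: "inj_on f I" "\<forall>i\<in>I. f i \<in> F i - C"
      by fastforce
    have "card (f ` I \<union> C) \<le> card I + card C"
      using card_Un_le[of "f ` I" C] card_image_le[OF insert.hyps(1), of f] by linarith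
    also have "\<dots> < card (F k)"
      using insert.prems[of k] insert.hyps by simp
    finally have "\<not> F k \<subseteq> f ` I \<union> C"
      using card_mono[of "f ` I \<union> C" "F k"] insert.hyps(1) assms(2) by auto
    then obtain y where y: "y \<in> F k" "y \<notin> f ` I" "y \<notin> C"
      by blast
    have "inj_on (f(k := y)) (insert k I)"
      using f(1) y insert.hyps by (auto simp: inj_on_def)
    moreover have "\<forall>i\<in>insert k I. (f(k := y)) i \<in> F i - C"
      using f(2) y by auto
    ultimately show ?case by blast
  qed
  then show ?thesis using that by blast
qed

text \<open>The inequality \<open>\<Prod>(1 - c j / m) \<ge> 1 - \<Sum> c j / m\<close>, multiplied
  by \<open>m ^ Suc (card J)\<close>. The sum is moved to the right to stay clear of truncated
  subtraction, and the extra factor \<open>m\<close> avoids the exponent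
  \<open>card J - 1\<close>.\<close>

lemma weierstrass_prod_nat:
  fixes c :: "'i \<Rightarrow> nat"
  assumes "finite J" "\<And>j. j \<in> J \<Longrightarrow> c j \<le> m"
  shows "m ^ Suc (card J) \<le> m * (\<Prod>j\<in>J. m - c j) + (\<Sum>j\<in>J. c j) * m ^ card J"
  using assms
proof (induction J rule: finite_induct)
  case empty
  then show ?case by simp
next
  case (insert k J)
  let ?P = "\<Prod>j\<in>J. m - c j" and ?S = "\<Sum>j\<in>J. c j"
  define d where "d = m - c k"
  then have "m = d + c k"
    using insert.prems[of k] by simp
  then have mP: "m * ?P = d * ?P + c k * ?P"
    by (metis distrib_right)
  have P: "?P \<le> m ^ card J"
    using prod_mono[of J "\<lambda>j. m - c j" "\<lambda>_. m"] by simp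
  have "m * m ^ Suc (card J) \<le> m * (m * ?P + ?S * m ^ card J)"
    using insert by (intro mult_le_mono) auto
  also have "\<dots> = m * (d * ?P) + m * c k * ?P + ?S * (m * m ^ card J)"
    unfolding mP by (simp add: algebra_simps)
  also have "\<dots> \<le> m * (d * ?P) + m * c k * m ^ card J + ?S * (m * m ^ card J)"
    using P by (intro add_mono mult_le_mono) auto
  also have "\<dots> = m * (d * ?P) + (c k + ?S) * (m * m ^ card J)"
    by (simp add: algebra_simps)
  finally show ?case
    using insert.hyps by (simp add: d_def)
qed

text \<open>Apply the product inequality to \<open>c j = card (A j \<inter> C)\<close>. By
  disjointness these numbers add up to the number of colours of \<open>C\<close> that occur in the
  lists at all.\<close>

lemma card_PiE_avoiding:
  fixes A :: "'i \<Rightarrow> 'c set"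
  assumes J: "finite J" and C: "finite C"
    and A: "\<And>j. j \<in> J \<Longrightarrow> finite (A j) \<and> card (A j) = m"
    and disj: "disjoint_family_on A J"
  shows "m ^ Suc (card J)
    \<le> m * card (\<Pi>\<^sub>E j\<in>J. A j - C) + card ((\<Union>j\<in>J. A j) \<inter> C) * m ^ card J"
proof -
  have "card (\<Pi>\<^sub>E j\<in>J. A j - C) = (\<Prod>j\<in>J. card (A j - C))"
    by (rule card_PiE[OF J])
  also have "\<dots> = (\<Prod>j\<in>J. m - card (A j \<inter> C))"
    using A by (intro prod.cong) (auto simp: card_Diff_subset_Int)
  finally have 1: "card (\<Pi>\<^sub>E j\<in>J. A j - C) = (\<Prod>j\<in>J. m - card (A j \<inter> C))" .
  have "card (\<Union>j\<in>J. A j \<inter> C) = (\<Sum>j\<in>J. card (A j \<inter> C))"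
    using J C disj by (intro card_UN_disjoint) (auto simp: disjoint_family_on_def)
  then have 2: "card ((\<Union>j\<in>J. A j) \<inter> C) = (\<Sum>j\<in>J. card (A j \<inter> C))"
    by (simp add: Int_UN_distrib2)
  have "card (A j \<inter> C) \<le> m" if "j \<in> J" for j
    using A[OF that] card_mono[of "A j" "A j \<inter> C"] by auto
  then show ?thesis
    unfolding 1 2 by (rule weierstrass_prod_nat[OF J])
qed

text \<open>The value \<open>t j\<close> avoids \<open>B\<close>, so it is some \<open>t' k\<close>,
  and disjointness of the lists forces \<open>k = j\<close>. The avoided set \<open>C\<close> may
  exceed \<open>B\<close>: a recoloured vertex gives up a colour of \<open>X\<close> that
  \<open>t\<close> must still avoid.\<close>

lemma transversal_eqI:
  assumes "disjoint_family_on A J"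
    and "t \<in> (\<Pi>\<^sub>E j\<in>J. A j - C)" "t' \<in> (\<Pi>\<^sub>E j\<in>J. A j - C)"
    and "B \<subseteq> C" "B \<union> t ` J = B \<union> t' ` J"
  shows "t = t'"
proof (rule PiE_ext[OF assms(2,3)])
  fix j assume j: "j \<in> J"
  then have "t j \<in> t' ` J"
    using assms(2,4,5) by fastforce
  then obtain k where "k \<in> J" "t j = t' k" by blast
  moreover from this have "k = j"
    using assms(1-3) j by (fastforce simp: disjoint_family_on_def PiE_iff)
  ultimately show "t j = t' j" by simp
qed

section \<open>Many colourings with distinct colour sets\<close>

lemma many_color_sets:
  fixes D A :: "nat \<Rightarrow> nat set" and n a :: nat
  defines "\<Omega> \<equiv> {(g, t). inj_on g {..<n} \<and> (\<forall>i<n. g i \<in> D i) \<and> (\<forall>j<a. t j \<in> A j)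
    \<and> g ` {..<n} \<inter> t ` {..<a} = {}}"
  assumes a: "2 \<le> a"
    and D: "\<And>i. i < n \<Longrightarrow> finite (D i) \<and> card (D i) = n + a"
    and A: "\<And>j. j < a \<Longrightarrow> finite (A j) \<and> card (A j) = n + a"
    and disj: "disjoint_family_on A {..<a}"
  obtains \<Psi> where "\<Psi> \<subseteq> \<Omega>" "(n + a) ^ a \<le> card \<Psi>"
    "inj_on (\<lambda>(g, t). g ` {..<n} \<union> t ` {..<a}) \<Psi>"
proof -
  define m where "m = n + a"
  obtain x where x: "inj_on x {..<n}" "\<And>i. i < n \<Longrightarrow> x i \<in> D i"
    using greedy_distinct_representatives[of "{..<n}" "{}" D] D by auto
  define X where "X = x ` {..<n}"
  have X: "finite X" "card X = n"
    using x(1) by (auto simp: X_def card_image)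
  \<comment> \<open>Room for recolouring: \<open>D i\<close> has \<open>n + a\<close> colours and
    \<open>X\<close> only \<open>n\<close>. As \<open>z i\<close> lies outside \<open>X\<close>, the
    recoloured map stays injective.\<close>
  have "\<exists>z. z \<in> D i - X" if "i < n" for i
  proof -
    have "\<not> D i \<subseteq> X"
      using card_mono[of X "D i"] X D[OF that] a by auto
    then show ?thesis by blast
  qed
  then obtain z where z: "\<And>i. i < n \<Longrightarrow> z i \<in> D i - X"
    by metis
  define U where "U = (\<Union>j\<in>{..<a}. A j)"
  define I where "I = {i. i < n \<and> x i \<in> U}"
  define P where "P C = (\<Pi>\<^sub>E j\<in>{..<a}. A j - C)" for C
  have finP: "finite (P C)" for C
    unfolding P_def using A by (intro finite_PiE) auto
  have I: "finite I" "card I = card (U \<inter> X)"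
  proof -
    show "finite I" by (simp add: I_def)
    have "x ` I = U \<inter> X" by (auto simp: I_def X_def)
    moreover have "inj_on x I"
      using x(1) by (rule inj_on_subset) (auto simp: I_def)
    ultimately show "card I = card (U \<inter> X)"
      by (metis card_image)
  qed
  have m: "m > 0" and ma: "m ^ a = m * m ^ (a - 1)"
    using a by (simp_all add: m_def power_eq_if)
  have cardP: "m * m ^ a \<le> m * card (P C) + card (U \<inter> C) * m ^ a" if "finite C" for C
    using card_PiE_avoiding[OF _ that, of "{..<a}" A m] A disj
    by (simp add: P_def U_def m_def)
  have PX: "m ^ a \<le> card (P X) + card I * m ^ (a - 1)"
  proof -
    have "m * m ^ a \<le> m * (card (P X) + card I * m ^ (a - 1))"
      using cardP[OF X(1)] I(2) ma by (simp add: algebra_simps)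
    then show ?thesis using m by simp
  qed
  \<comment> \<open>At most \<open>n + 1 \<le> m - 1\<close> colours are avoided, because
    \<open>a \<ge> 2\<close>; so at most \<open>(m - 1) * m^(a-1)\<close> of the \<open>m^a\<close>
    transversals are lost.\<close>
  have Pz: "m ^ (a - 1) \<le> card (P (insert (z i) X))" for i
  proof -
    have "card (U \<inter> insert (z i) X) \<le> card (insert (z i) X)"
      using X by (intro card_mono) auto
    also have "\<dots> \<le> m - 1"
      using card_insert_le_m1[of "m - 1" X "z i"] X a by (simp add: m_def card_insert_if)
    finally have "card (U \<inter> insert (z i) X) * m ^ a \<le> (m - 1) * m ^ a"
      by (rule mult_le_mono1)
    then have "m * m ^ a \<le> m * card (P (insert (z i) X)) + (m - 1) * m ^ a"
      using cardP[of "insert (z i) X"] X(1) by (meson add_left_mono finite_insert order_trans)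
    moreover have "m * m ^ a = (m - 1) * m ^ a + m ^ a"
      using m by (simp add: mult_eq_if)
    ultimately have "m * m ^ (a - 1) \<le> m * card (P (insert (z i) X))"
      using ma by simp
    then show ?thesis using m by simp
  qed
  define \<Psi>0 where "\<Psi>0 = {x} \<times> P X"
  define \<Psi>1 where "\<Psi>1 i = {x(i := z i)} \<times> P (insert (z i) X)" for i
  define \<Psi> where "\<Psi> = \<Psi>0 \<union> (\<Union>i\<in>I. \<Psi>1 i)"
  have upd: "x(i := z i) \<noteq> x" if "i < n" for i
    using z[OF that] that by (auto simp: X_def fun_eq_iff)
  have upd_im: "x(i := z i) ` {..<n} = insert (z i) (X - {x i})" if "i < n" for i
    using x(1) that by (auto simp: X_def inj_on_def)
  have X_sub: "x i \<in> X" if "i < n" for i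
    using that by (simp add: X_def)
  have upd_eq: "i = k" if "x(i := z i) = x(k := z k)" "i < n" "k < n" for i k
    using that z[of i] X_sub[of i] by (metis DiffD2 fun_upd_apply)
  \<comment> \<open>The families are disjoint since their first components \<open>x\<close> and
    \<open>x(i := z i)\<close> are pairwise different.\<close>
  have card: "card \<Psi> = card (P X) + (\<Sum>i\<in>I. card (P (insert (z i) X)))"
  proof -
    have "card \<Psi> = card \<Psi>0 + card (\<Union>i\<in>I. \<Psi>1 i)"
      unfolding \<Psi>_def using I finP upd
      by (intro card_Un_disjoint) (force simp: \<Psi>0_def \<Psi>1_def I_def)+
    also have "card (\<Union>i\<in>I. \<Psi>1 i) = (\<Sum>i\<in>I. card (\<Psi>1 i))"
      using I finP upd_eq by (intro card_UN_disjoint) (auto simp: \<Psi>1_def I_def)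
    finally show ?thesis
      by (simp add: \<Psi>0_def \<Psi>1_def card_cartesian_product)
  qed
  have "m ^ a \<le> card \<Psi>"
  proof -
    \<comment> \<open>The recolourings make up exactly for the deficit allowed in
      \<open>PX\<close>.\<close>
    have "card I * m ^ (a - 1) \<le> (\<Sum>i\<in>I. card (P (insert (z i) X)))"
      using sum_mono[of I "\<lambda>_. m ^ (a - 1)"] Pz by simp
    then show ?thesis using PX card by linarith
  qed
  moreover have "\<Psi> \<subseteq> \<Omega>"
  proof
    fix p assume "p \<in> \<Psi>"
    then consider t where "p = (x, t)" "t \<in> P X"
      | i t where "i \<in> I" "p = (x(i := z i), t)" "t \<in> P (insert (z i) X)"
      unfolding \<Psi>_def \<Psi>0_def \<Psi>1_def by blast
    then show "p \<in> \<Omega>"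
    proof cases
      case 1
      moreover from this have "X \<inter> t ` {..<a} = {}" "\<forall>j<a. t j \<in> A j"
        by (auto simp: P_def PiE_iff)
      ultimately show ?thesis
        using x by (simp add: \<Omega>_def X_def)
    next
      case 2
      then have i: "i < n" by (simp add: I_def)
      have "inj_on (x(i := z i)) {..<n}"
        using x(1) z[OF i] X_sub by (auto intro!: inj_on_fun_updI simp: X_def)
      moreover have "x(i := z i) ` {..<n} \<inter> t ` {..<a} = {}"
        unfolding upd_im[OF i] using 2(3) by (fastforce simp: P_def PiE_iff)
      moreover have "\<forall>k<n. (x(i := z i)) k \<in> D k"
        using x(2) z[OF i] by simp
      moreover have "\<forall>j<a. t j \<in> A j"
        using 2(3) by (simp add: P_def PiE_iff)
      ultimately show ?thesis
        using 2(2) by (simp add: \<Omega>_def)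
    qed
  qed
  moreover have "inj_on (\<lambda>(g, t). g ` {..<n} \<union> t ` {..<a}) \<Psi>"
  proof -
    define S where "S = (\<lambda>(g :: nat \<Rightarrow> nat, t :: nat \<Rightarrow> nat). g ` {..<n} \<union> t ` {..<a})"
    have S0: "X - S (x, t) = {}" for t
      by (auto simp: S_def X_def)
    \<comment> \<open>Since \<open>t\<close> avoids all of \<open>X\<close>, the freed colour
      \<open>x i\<close> is not reused, and it identifies \<open>i\<close>.\<close>
    have S1: "X - S (x(i := z i), t) = {x i}" if "i \<in> I" "t \<in> P (insert (z i) X)" for i t
    proof -
      have i: "i < n" using that by (simp add: I_def)
      have "t ` {..<a} \<inter> X = {}"
        using that(2) by (auto simp: P_def PiE_iff)
      moreover have "S (x(i := z i), t) = insert (z i) (X - {x i}) \<union> t ` {..<a}"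
        by (simp only: S_def prod.case upd_im[OF i])
      ultimately show ?thesis
        using z[OF i] X_sub[OF i] by auto
    qed
    have "p = q" if pq: "p \<in> \<Psi>" "q \<in> \<Psi>" and eq: "S p = S q" for p q
    proof -
      have cases: "(\<exists>t. r = (x, t) \<and> t \<in> P X) \<or>
          (\<exists>i t. i \<in> I \<and> r = (x(i := z i), t) \<and> t \<in> P (insert (z i) X))" if "r \<in> \<Psi>" for r
        using that unfolding \<Psi>_def \<Psi>0_def \<Psi>1_def by blast
      have missing: "X - S p = X - S q" using eq by simp
      \<comment> \<open>Mixed pairs cannot occur: the missing part of \<open>X\<close> would be both
        empty and a singleton.\<close>
      consider t t' where "p = (x, t)" "t \<in> P X" "q = (x, t')" "t' \<in> P X"
        | i t k t' where "i \<in> I" "p = (x(i := z i), t)" "t \<in> P (insert (z i) X)"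
            "k \<in> I" "q = (x(k := z k), t')" "t' \<in> P (insert (z k) X)"
        using cases[OF pq(1)] cases[OF pq(2)] missing S0 S1
        by (metis insert_not_empty)
      then show ?thesis
      proof cases
        case 1
        then have "t = t'"
          using eq transversal_eqI[OF disj, of t X t' X] by (simp add: P_def S_def X_def)
        then show ?thesis using 1 by simp
      next
        case 2
        then have "x i = x k"
          using missing S1 by (metis singleton_inject)
        then have ik: "i = k" and i: "i < n"
          using x(1) 2 by (auto simp: inj_on_def I_def)
        have "t = t'"
          using 2 eq upd_im[OF i] ik
            transversal_eqI[OF disj, of t "insert (z i) X" t' "insert (z i) (X - {x i})"]
          by (auto simp: P_def S_def)
        then show ?thesis using 2 ik by simp
      qed
    qed
    then show ?thesis
      unfolding S_def[symmetric] by (auto intro: inj_onI)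
  qed
  ultimately show ?thesis
    using that by (simp add: m_def)
qed

section \<open>Choosability of the join\<close>

lemma proper_coloring_join_iff:
  "proper_coloring (graph_join (complete_graph n) (complete_bipartite_graph a b)) c \<longleftrightarrow>
    inj_on (\<lambda>i. c (Inl i)) {..<n} \<and>
    (\<forall>i<n. \<forall>j<a. c (Inl i) \<noteq> c (Inr (Inl j))) \<and>
    (\<forall>i<n. \<forall>k<b. c (Inl i) \<noteq> c (Inr (Inr k))) \<and>
    (\<forall>j<a. \<forall>k<b. c (Inr (Inl j)) \<noteq> c (Inr (Inr k)))"
  unfolding proper_coloring_def graph_join_def complete_graph_def complete_bipartite_graph_def
    inj_on_def
  by (fastforce simp: ball_Un)

lemma pverts_join:
  "pverts (graph_join (complete_graph n) (complete_bipartite_graph a b)) =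
    Inl ` {..<n} \<union> Inr ` Inl ` {..<a} \<union> Inr ` Inr ` {..<b}"
  by (auto simp: graph_join_def complete_graph_def complete_bipartite_graph_def)

lemma choosable_join:
  assumes a: "2 \<le> a" and b: "b < (n + a) ^ a"
  shows "choosable (graph_join (complete_graph n) (complete_bipartite_graph a b)) (n + a)"
  unfolding choosable_def
proof (intro allI impI)
  let ?G = "graph_join (complete_graph n) (complete_bipartite_graph a b)"
  fix L assume L: "list_assignment ?G (n + a) L"
  define D A B where "D i = L (Inl i)" and "A j = L (Inr (Inl j))" and "B k = L (Inr (Inr k))"
    for i j k
  have D: "finite (D i) \<and> card (D i) = n + a" if "i < n" for i
    using L that by (simp add: list_assignment_def pverts_join D_def)
  have A: "finite (A j) \<and> card (A j) = n + a" if "j < a" for j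
    using L that by (simp add: list_assignment_def pverts_join A_def ball_Un)
  have B: "finite (B k) \<and> card (B k) = n + a" if "k < b" for k
    using L that by (simp add: list_assignment_def pverts_join B_def ball_Un)
  have extend: "\<exists>c. proper_coloring ?G c \<and> (\<forall>v\<in>pverts ?G. c v \<in> L v)"
    if g: "inj_on g {..<n}" "\<forall>i<n. g i \<in> D i" and t: "\<forall>j<a. t j \<in> A j"
      and gt: "g ` {..<n} \<inter> t ` {..<a} = {}"
      and free: "\<forall>k<b. \<not> B k \<subseteq> g ` {..<n} \<union> t ` {..<a}" for g t
  proof -
    from free have "\<forall>k<b. \<exists>y. y \<in> B k \<and> y \<notin> g ` {..<n} \<union> t ` {..<a}"
      by blast
    then obtain y where y: "\<forall>k<b. y k \<in> B k \<and> y k \<notin> g ` {..<n} \<union> t ` {..<a}"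
      by metis
    define c where "c = case_sum g (case_sum t y)"
    have "g i \<noteq> t j" if "i < n" "j < a" for i j
      using gt that by blast
    moreover have "g i \<noteq> y k" if "i < n" "k < b" for i k
      using y that by (metis UnI1 imageI lessThan_iff)
    moreover have "t j \<noteq> y k" if "j < a" "k < b" for j k
      using y that by (metis UnI2 imageI lessThan_iff)
    ultimately have "proper_coloring ?G c"
      using g(1) by (simp add: proper_coloring_join_iff c_def)
    moreover have "\<forall>v\<in>pverts ?G. c v \<in> L v"
      using g t y by (auto simp: pverts_join c_def D_def A_def B_def)
    ultimately show ?thesis by blast
  qed
  show "\<exists>c. proper_coloring ?G c \<and> (\<forall>v\<in>pverts ?G. c v \<in> L v)"
  proof (cases "disjoint_family_on A {..<a}")
    case True
    obtain \<Psi> where \<Psi>: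
        "\<Psi> \<subseteq> {(g, t). inj_on g {..<n} \<and> (\<forall>i<n. g i \<in> D i) \<and> (\<forall>j<a. t j \<in> A j)
          \<and> g ` {..<n} \<inter> t ` {..<a} = {}}"
        "(n + a) ^ a \<le> card \<Psi>"
        "inj_on (\<lambda>(g, t). g ` {..<n} \<union> t ` {..<a}) \<Psi>"
      by (rule many_color_sets[OF a D A True])
    let ?S = "\<lambda>(g, t). g ` {..<n} \<union> t ` {..<a}"
    \<comment> \<open>Pigeonhole: there are more colour sets than the at most \<open>b\<close> lists
      \<open>B k\<close>.\<close>
    have "\<not> ?S ` \<Psi> \<subseteq> B ` {..<b}"
    proof
      assume "?S ` \<Psi> \<subseteq> B ` {..<b}"
      then have "card (?S ` \<Psi>) \<le> card (B ` {..<b})"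
        by (intro card_mono) auto
      also have "\<dots> \<le> b"
        using card_image_le[of "{..<b}" B] by simp
      finally show False
        using \<Psi>(2) card_image[OF \<Psi>(3)] b by linarith
    qed
    then obtain g t where gt: "(g, t) \<in> \<Psi>" "g ` {..<n} \<union> t ` {..<a} \<notin> B ` {..<b}"
      by (fastforce simp: image_subset_iff)
    have "\<not> B k \<subseteq> g ` {..<n} \<union> t ` {..<a}" if "k < b" for k
    proof
      assume "B k \<subseteq> g ` {..<n} \<union> t ` {..<a}"
      moreover have "card (g ` {..<n} \<union> t ` {..<a}) \<le> n + a"
        using card_Un_le[of "g ` {..<n}" "t ` {..<a}"] card_image_le[of "{..<n}" g]
          card_image_le[of "{..<a}" t] by simp
      ultimately have "B k = g ` {..<n} \<union> t ` {..<a}"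
        using B[OF that] by (intro card_seteq) auto
      then show False using gt(2) that by blast
    qed
    then show ?thesis
      using subsetD[OF \<Psi>(1) gt(1)] extend[of g t] by simp
  next
    case False
    then obtain p q y where pq: "p < a" "q < a" "p \<noteq> q" "y \<in> A p" "y \<in> A q"
      by (auto simp: disjoint_family_on_def)
    \<comment> \<open>Both \<open>p\<close> and \<open>q\<close> get the common colour
      \<open>y\<close>. The other \<open>n + a - 2\<close> vertices are coloured greedily without
      \<open>y\<close>, so at most \<open>n + a - 1\<close> colours occur and no \<open>B k\<close>
      is exhausted.\<close>
    define J where "J = {..<a} - {p, q}"
    have "card J = a - 2"
      using pq by (simp add: J_def card_Diff_subset)
    then have card: "card ({..<n} <+> J) = n + a - 2"
      using a by (simp add: card_Plus J_def)
    obtain f where f: "inj_on f ({..<n} <+> J)"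
        "\<And>v. v \<in> {..<n} <+> J \<Longrightarrow> f v \<in> case_sum D A v - {y}"
    proof (rule greedy_distinct_representatives[of "{..<n} <+> J" "{y}" "case_sum D A"])
      show "card ({..<n} <+> J) + card {y} \<le> card (case_sum D A v)" if "v \<in> {..<n} <+> J" for v
        using that card D A a by (auto simp: J_def)
    qed (auto simp: J_def)
    define g t where "g i = f (Inl i)" and "t j = (if j \<in> {p, q} then y else f (Inr j))" for i j
    have g: "inj_on g {..<n}" "\<forall>i<n. g i \<in> D i - {y}"
      using f by (force simp: inj_on_def g_def)+
    have t: "\<forall>j<a. t j \<in> A j"
      using f(2)[of "Inr _"] pq by (auto simp: t_def J_def)
    have gt: "g ` {..<n} \<inter> t ` {..<a} = {}"
      using f(1) g(2) by (auto simp: t_def g_def J_def inj_on_def)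
    have "g ` {..<n} \<union> t ` {..<a} \<subseteq> insert y (f ` ({..<n} <+> J))"
      by (auto simp: g_def t_def J_def)
    then have "card (g ` {..<n} \<union> t ` {..<a}) \<le> card (insert y (f ` ({..<n} <+> J)))"
      by (intro card_mono) (auto simp: J_def)
    also have "\<dots> \<le> Suc (card (f ` ({..<n} <+> J)))"
      by (rule card_insert_le_m1) auto
    also have "\<dots> < n + a"
      using card_image[OF f(1)] card a by simp
    finally have small: "card (g ` {..<n} \<union> t ` {..<a}) < n + a" .
    have "\<not> B k \<subseteq> g ` {..<n} \<union> t ` {..<a}" if "k < b" for k
      using card_mono[of "g ` {..<n} \<union> t ` {..<a}" "B k"] small B[OF that] by auto
    then show ?thesis
      using g t gt by (intro extend[of g t]) auto
  qed
qed

section \<open>Chromatic number of the join and the bound on \<open>tau\<close>\<close>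

lemma chromatic_number_join_ge:
  assumes "a > 0" "b > 0"
  shows "n + 2 \<le> chromatic_number (graph_join (complete_graph n) (complete_bipartite_graph a b))"
    (is "_ \<le> chromatic_number ?G")
proof -
  \<comment> \<open>An explicit colouring guarantees that the \<open>LEAST\<close> in
    \<open>chromatic_number\<close> is attained.\<close>
  define c0 where "c0 = case_sum id (case_sum (\<lambda>_::nat. n) (\<lambda>_::nat. n + 1))"
  have "colorable ?G (n + 2)"
    unfolding colorable_def
    by (rule exI[of _ c0]) (auto simp: c0_def proper_coloring_join_iff pverts_join inj_on_def)
  then have "colorable ?G (chromatic_number ?G)"
    unfolding chromatic_number_def by (rule LeastI)
  then obtain c where c: "proper_coloring ?G c" "\<forall>v\<in>pverts ?G. c v < chromatic_number ?G"
    unfolding colorable_def by blast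
  \<comment> \<open>The colours on a clique of size \<open>n + 2\<close>: all of
    \<open>K\<^sub>n\<close> and one vertex from each part.\<close>
  let ?V = "insert (c (Inr (Inl 0))) (insert (c (Inr (Inr 0))) ((\<lambda>i. c (Inl i)) ` {..<n}))"
  have "c (Inr (Inl 0)) \<noteq> c (Inr (Inr 0))" "c (Inr (Inl 0)) \<notin> (\<lambda>i. c (Inl i)) ` {..<n}"
    "c (Inr (Inr 0)) \<notin> (\<lambda>i. c (Inl i)) ` {..<n}" "inj_on (\<lambda>i. c (Inl i)) {..<n}"
    using c(1) assms unfolding proper_coloring_join_iff by fastforce+
  then have "card ?V = n + 2"
    by (simp add: card_insert_if card_image)
  moreover have "?V \<subseteq> {..<chromatic_number ?G}"
    using c(2) assms by (auto simp: pverts_join)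
  ultimately show ?thesis
    using card_mono[of "{..<chromatic_number ?G}" ?V] by simp
qed

theorem theorem10:
  fixes s l b :: nat
  assumes "l > 0" and "b > 0" and "b \<le> (l + s + 1) ^ (s + 2) - 1"
  shows "tau s (s + 2) b \<le> l - 1"
proof -
  let ?G = "graph_join (complete_graph (l - 1)) (complete_bipartite_graph (s + 2) b)"
  have eq: "l - 1 + (s + 2) = l + s + 1"
    using assms(1) by simp
  have "(l + s + 1) ^ (s + 2) > 0"
    by simp
  then have "b < (l - 1 + (s + 2)) ^ (s + 2)"
    unfolding eq using assms(3) by linarith
  then have "choosable ?G (l - 1 + (s + 2))"
    by (intro choosable_join) auto
  then have "list_chromatic_number ?G \<le> l + s + 1"
    unfolding list_chromatic_number_def eq by (rule Least_le)
  \<comment> \<open>With \<open>n = l - 1\<close> the bound \<open>n + 2\<close> is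
    \<open>l + 1\<close>, so the difference is at most
    \<open>(l + s + 1) - (l + 1) = s\<close>.\<close>
  moreover have "l + 1 \<le> chromatic_number ?G"
    using chromatic_number_join_ge[of "s + 2" b "l - 1"] assms by simp
  ultimately show ?thesis
    unfolding tau_def by (intro Least_le) linarith
qed

end
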